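(* Let $X$ and $Y$ be finite $T_0$ topological spaces. If $f:X\to Y$ is a Vietoris-like map, then $f$ induces isomorphisms in all homology groups.
   Context: A finite $T_0$ topological space is identified with a finite poset: $x\le y$ iff $U_x\subseteq U_y$, where $U_x$ is the intersection of all open sets containing $x$ (so the open sets are the lower sets); continuous maps are exactly the order-preserving maps. Homology is singular homology with integer coefficients. A space is acyclic if its homology groups are isomorphic to those of a point. A continuous map $f:X\to Y$ between finite $T_0$ spaces is called a Vietoris-like map if for every chain $y_1<y_2<\dots<y_n$ in $Y$ ($n\ge1$) the subspace $\bigcup_{i=1}^n f^{-1}(y_i)$ of $X$ is acyclic. *)

theory Defs
  imports "HOL-Analysis.Analysis" "HOL-Homology.Homology"
begin

definition minimal_open :: "'a topology \<Rightarrow> 'a \<Rightarrow> 'a set" where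
  "minimal_open X x = \<Inter>{U. openin X U \<and> x \<in> U}"

(* The relation is meaningful for points of the space only: minimal_open X x is UNIV
   when x is not in topspace X. *)
definition point_le :: "'a topology \<Rightarrow> 'a \<Rightarrow> 'a \<Rightarrow> bool" where
  "point_le X x y \<longleftrightarrow> minimal_open X x \<subseteq> minimal_open X y"

definition point_less :: "'a topology \<Rightarrow> 'a \<Rightarrow> 'a \<Rightarrow> bool" where
  "point_less X x y \<longleftrightarrow> point_le X x y \<and> x \<noteq> y"

(* Homology is unreduced, so an acyclic space is nonempty. *)
definition acyclic_space :: "'a topology \<Rightarrow> bool" where
  "acyclic_space X \<longleftrightarrow>
     (\<forall>p. homology_group p X \<cong> homology_group p (discrete_topology {()}))"

definition Vietoris_like_map :: "'a topology \<Rightarrow> 'b topology \<Rightarrow> ('a \<Rightarrow> 'b) \<Rightarrow> bool" where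
  "Vietoris_like_map X Y f \<longleftrightarrow>
     continuous_map X Y f \<and>
     (\<forall>ys. ys \<noteq> [] \<longrightarrow> set ys \<subseteq> topspace Y \<longrightarrow> sorted_wrt (point_less Y) ys \<longrightarrow>
        acyclic_space (subtopology X (\<Union>y\<in>set ys. {x \<in> topspace X. f x = y})))"

end

theory Submission
  imports Defs
begin

text \<open>
  The hypothesis concerns preimages of chains, which are neither open nor closed in general, so it
  cannot be fed directly into an excision argument. Replacing both spaces by their barycentric
  subdivisions repairs this. The subdivision of a finite \<open>T\<^sub>0\<close> space has the nonempty chains as points
  and the families closed under nonempty subchains as open sets, so the minimal open set of a chain
  consists of its nonempty subchains. A continuous map \<open>f\<close> induces a map of subdivisions by taking
  images, and taking the greatest element of a chain is a continuous map to the original space. These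
  maps form a commutative square with \<open>f\<close>.

  Three sides of the square are homology equivalences by one criterion
  (\<open>homology_equivalence_locally_acyclic\<close>): a map to a finite space is a homology equivalence if the
  preimages of the minimal open sets are acyclic. Minimal open sets are contractible, and larger open
  sets are built from them by unions, so excision and the five lemma propagate the isomorphism from
  the minimal open sets to the whole space (\<open>homology_equivalence_Mayer_Vietoris\<close>).

  For the greatest-element map, the preimage of the minimal open set of \<open>y\<close> is the subdivision of that
  set, which is a cone with apex \<open>{y}\<close> (\<open>homology_equivalence_chain_top\<close>). For the map of subdivisions,
  the preimage of the minimal open set of a chain \<open>c\<close> is the subdivision of the \<open>f\<close>-preimage
  of \<open>c\<close>. Its homology is that of the subspace itself, by the previous case, and this subspace is
  acyclic because \<open>f\<close> is Vietoris-like. The fourth side of the square, \<open>f\<close>, is then a homology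
  equivalence as well.
\<close>

section \<open>Five lemmas for exact sequences of pairs\<close>

text \<open>
  Injectivity: an element of the kernel comes from \<open>A2\<close>, and surjectivity of \<open>h1\<close> shows that
  it comes even from \<open>A1\<close>. Surjectivity: injectivity of \<open>h5\<close> lets one lift the image in \<open>B4\<close> of
  the target element to \<open>A3\<close>, and the lift is corrected by an element of \<open>A2\<close>.
\<close>

lemma five_lemma:
  assumes exA: "exact_seq ([A5, A4, A3, A2, A1], [a4, a3, a2, a1])"
    and exB: "exact_seq ([B5, B4, B3, B2, B1], [b4, b3, b2, b1])"
    and h1: "h1 \<in> epi A1 B1" and h2: "h2 \<in> iso A2 B2" and h3: "h3 \<in> hom A3 B3"
    and h4: "h4 \<in> iso A4 B4" and h5: "h5 \<in> mon A5 B5"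
    and sq1: "\<And>x. x \<in> carrier A1 \<Longrightarrow> h2 (a1 x) = b1 (h1 x)"
    and sq2: "\<And>x. x \<in> carrier A2 \<Longrightarrow> h3 (a2 x) = b2 (h2 x)"
    and sq3: "\<And>x. x \<in> carrier A3 \<Longrightarrow> h4 (a3 x) = b3 (h3 x)"
    and sq4: "\<And>x. x \<in> carrier A4 \<Longrightarrow> h5 (a4 x) = b4 (h4 x)"
  shows "h3 \<in> iso A3 B3"
proof -
  have homs: "group_hom A1 A2 a1" "group_hom A2 A3 a2" "group_hom A3 A4 a3" "group_hom A4 A5 a4"
     "group_hom B1 B2 b1" "group_hom B2 B3 b2" "group_hom B3 B4 b3" "group_hom B4 B5 b4"
    using exA exB by (auto simp: group_hom_def group_hom_axioms_def)
  interpret a1: group_hom A1 A2 a1 by fact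
  interpret a2: group_hom A2 A3 a2 by fact
  interpret a3: group_hom A3 A4 a3 by fact
  interpret a4: group_hom A4 A5 a4 by fact
  interpret b1: group_hom B1 B2 b1 by fact
  interpret b2: group_hom B2 B3 b2 by fact
  interpret b3: group_hom B3 B4 b3 by fact
  interpret b4: group_hom B4 B5 b4 by fact
  have "group_hom A1 B1 h1" "group_hom A2 B2 h2" "group_hom A3 B3 h3" "group_hom A4 B4 h4" 
    "group_hom A5 B5 h5"
    using h1 h2 h3 h4 h5 by (auto simp: group_hom_def group_hom_axioms_def epi_def mon_def iso_def)
  then interpret h1: group_hom A1 B1 h1 + h2: group_hom A2 B2 h2 + h3: group_hom A3 B3 h3 + 
     h4: group_hom A4 B4 h4 + h5: group_hom A5 B5 h5 by auto
  have kA: "kernel A2 A3 a2 = a1 ` carrier A1" "kernel A3 A4 a3 = a2 ` carrier A2"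
     "kernel A4 A5 a4 = a3 ` carrier A3"
    and kB: "kernel B2 B3 b2 = b1 ` carrier B1" "kernel B3 B4 b3 = b2 ` carrier B2"
     "kernel B4 B5 b4 = b3 ` carrier B3"
    using exA exB by auto
  have s1: "h1 ` carrier A1 = carrier B1" using h1 by (auto simp: epi_def)
  have s2: "h2 ` carrier A2 = carrier B2" and i2: "inj_on h2 (carrier A2)"
    and s4: "h4 ` carrier A4 = carrier B4" and i4: "inj_on h4 (carrier A4)"
    using h2 h4 by (auto simp: iso_def bij_betw_def)
  have i5: "inj_on h5 (carrier A5)" using h5 by (auto simp: mon_def)
  show ?thesis
  proof (subst h3.iso_iff, intro conjI ballI impI subsetI)
    fix x assume x: "x \<in> carrier A3" and "h3 x = \<one>\<^bsub>B3\<^esub>"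
    then have "h4 (a3 x) = \<one>\<^bsub>B4\<^esub>" by (simp add: sq3)
    then have "a3 x = \<one>\<^bsub>A4\<^esub>"
      using i4 x by (metis a3.hom_closed h4.hom_one h4.inj_on_one_iff)
    then obtain y where y: "y \<in> carrier A2" "x = a2 y"
      using kA(2) x by (auto simp: kernel_def)
    then have "h2 y \<in> kernel B2 B3 b2"
      using \<open>h3 x = _\<close> by (simp add: kernel_def flip: sq2)
    then obtain z where z: "z \<in> carrier A1" "h2 y = b1 (h1 z)"
      using kB(1) s1 by (metis imageE)
    then have "y = a1 z"
      using i2 y by (metis a1.hom_closed inj_onD sq1)
    then have "y \<in> kernel A2 A3 a2"
      using kA(1) z by blast
    then show "x = \<one>\<^bsub>A3\<^esub>"
      using y by (simp add: kernel_def)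
  next
    fix b assume b: "b \<in> carrier B3"
    then obtain y where y: "y \<in> carrier A4" "h4 y = b3 b"
      using s4 by (metis b3.hom_closed imageE)
    have "b3 b \<in> kernel B4 B5 b4" using b kB(3) by blast
    then have "h5 (a4 y) = \<one>\<^bsub>B5\<^esub>" using y by (simp add: sq4 kernel_def)
    then have "a4 y = \<one>\<^bsub>A5\<^esub>"
      using i5 y by (metis a4.hom_closed h5.inj_on_one_iff)
    then obtain x where x: "x \<in> carrier A3" "y = a3 x"
      using kA(3) y by (auto simp: kernel_def)
    \<comment> \<open>The difference of \<open>b\<close> and the image of \<open>x\<close> dies in \<open>B4\<close>, so it comes from \<open>A2\<close>.\<close>
    let ?d = "b \<otimes>\<^bsub>B3\<^esub> inv\<^bsub>B3\<^esub> h3 x"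
    have "b3 ?d = \<one>\<^bsub>B4\<^esub>"
      using b x y by (simp flip: sq3)
    then have "?d \<in> kernel B3 B4 b3"
      using b x by (simp add: kernel_def)
    then obtain c where c: "c \<in> carrier A2" "?d = b2 (h2 c)"
      using kB(2) s2 by (metis imageE)
    have "h3 (a2 c \<otimes>\<^bsub>A3\<^esub> x) = ?d \<otimes>\<^bsub>B3\<^esub> h3 x"
      using c x by (simp add: sq2)
    also have "\<dots> = b"
      using b x by (simp add: b2.m_assoc)
    finally show "b \<in> h3 ` carrier A3"
      using c x by (metis a2.hom_closed a2.m_closed imageI)
  qed
qed

lemma continuous_map_restrict_pair:
  assumes "continuous_map X Y f" "f \<in> S \<rightarrow> T"
  shows "continuous_map (subtopology X S) (subtopology Y T) f"
  using assms by (auto simp: continuous_map_in_subtopology continuous_map_from_subtopology)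

text \<open>
  The two windows of length five are centred at the homology of the pair and of the space.
\<close>

lemma homology_long_exact_sequence:
  "exact_seq
     ([homology_group (p-1) X, homology_group (p-1) (subtopology X S), relative_homology_group p X S,
       homology_group p X, homology_group p (subtopology X S)],
      [hom_induced (p-1) (subtopology X S) {} X {} id, hom_boundary p X S, hom_induced p X {} X S id,
       hom_induced p (subtopology X S) {} X {} id])"
  "exact_seq
     ([homology_group (p-1) (subtopology X S), relative_homology_group p X S,
       homology_group p X, homology_group p (subtopology X S), relative_homology_group (p+1) X S],
      [hom_boundary p X S, hom_induced p X {} X S id,
       hom_induced p (subtopology X S) {} X {} id, hom_boundary (p+1) X S])"
  using homology_exactness_axiom_1[of p X S] homology_exactness_axiom_2[of p X S]
    homology_exactness_axiom_3[of p X S] homology_exactness_axiom_2[of "p+1" X S]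
  by simp_all

lemma homology_ladder_commutes:
  assumes f: "continuous_map X Y f" "f \<in> S \<rightarrow> T"
  shows "hom_induced p X {} Y {} f (hom_induced p (subtopology X S) {} X {} id x)
       = hom_induced p (subtopology Y T) {} Y {} id (hom_induced p (subtopology X S) {} (subtopology Y T) {} f x)"
    and "hom_induced p X S Y T f (hom_induced p X {} X S id y)
       = hom_induced p Y {} Y T id (hom_induced p X {} Y {} f y)"
    and "hom_induced p (subtopology X S) {} (subtopology Y T) {} f (hom_boundary (p+1) X S z)
       = hom_boundary (p+1) Y T (hom_induced (p+1) X S Y T f z)"
  using f continuous_map_restrict_pair[OF f] fun_cong[OF naturality_hom_induced[OF f, of "p+1"], of z]
  by (simp_all add: hom_induced_compose')

lemma iso_relative_homology:
  assumes f: "continuous_map X Y f" "f \<in> S \<rightarrow> T"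
    and X: "\<And>p. hom_induced p X {} Y {} f \<in> iso (homology_group p X) (homology_group p Y)"
    and S: "\<And>p. hom_induced p (subtopology X S) {} (subtopology Y T) {} f
              \<in> iso (homology_group p (subtopology X S)) (homology_group p (subtopology Y T))"
  shows "hom_induced p X S Y T f \<in> iso (relative_homology_group p X S) (relative_homology_group p Y T)"
proof (rule five_lemma[OF homology_long_exact_sequence(1) homology_long_exact_sequence(1)])
  show "hom_induced p (subtopology X S) {} (subtopology Y T) {} f
          \<in> epi (homology_group p (subtopology X S)) (homology_group p (subtopology Y T))"
    using S by (auto simp: iso_iff_mon_epi)
  show "hom_induced p X {} Y {} f \<in> iso (homology_group p X) (homology_group p Y)"
    by (rule X)
  show "hom_induced p X S Y T f \<in> hom (relative_homology_group p X S) (relative_homology_group p Y T)"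
    by (rule hom_induced_hom)
  show "hom_induced (p-1) (subtopology X S) {} (subtopology Y T) {} f
          \<in> iso (homology_group (p-1) (subtopology X S)) (homology_group (p-1) (subtopology Y T))"
    by (rule S)
  show "hom_induced (p-1) X {} Y {} f \<in> mon (homology_group (p-1) X) (homology_group (p-1) Y)"
    using X by (auto simp: iso_iff_mon_epi)
qed (use homology_ladder_commutes[OF f, of p] homology_ladder_commutes[OF f, of "p-1"] in auto)

lemma iso_absolute_homology:
  assumes f: "continuous_map X Y f" "f \<in> S \<rightarrow> T"
    and R: "\<And>p. hom_induced p X S Y T f \<in> iso (relative_homology_group p X S) (relative_homology_group p Y T)"
    and S: "\<And>p. hom_induced p (subtopology X S) {} (subtopology Y T) {} f
              \<in> iso (homology_group p (subtopology X S)) (homology_group p (subtopology Y T))"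
  shows "hom_induced p X {} Y {} f \<in> iso (homology_group p X) (homology_group p Y)"
proof (rule five_lemma[OF homology_long_exact_sequence(2) homology_long_exact_sequence(2)])
  show "hom_induced (p+1) X S Y T f \<in> epi (relative_homology_group (p+1) X S) (relative_homology_group (p+1) Y T)"
    using R by (auto simp: iso_iff_mon_epi)
  show "hom_induced p (subtopology X S) {} (subtopology Y T) {} f
          \<in> iso (homology_group p (subtopology X S)) (homology_group p (subtopology Y T))"
    by (rule S)
  show "hom_induced p X {} Y {} f \<in> hom (homology_group p X) (homology_group p Y)"
    by (rule hom_induced_hom)
  show "hom_induced p X S Y T f \<in> iso (relative_homology_group p X S) (relative_homology_group p Y T)"
    by (rule R)
  show "hom_induced (p-1) (subtopology X S) {} (subtopology Y T) {} f
          \<in> mon (homology_group (p-1) (subtopology X S)) (homology_group (p-1) (subtopology Y T))"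
    using S by (auto simp: iso_iff_mon_epi)
qed (use homology_ladder_commutes[OF f, of p] homology_ladder_commutes[OF f, of "p-1"] in auto)

section \<open>Gluing homology equivalences along open covers\<close>

text \<open>
  Excising the complement of \<open>V\<close> is legitimate: this set is closed, and it lies in the open set
  \<open>U\<close> because the two sets cover the space.
\<close>

lemma iso_excision_open:
  assumes U: "openin X U" and V: "openin X V" and UV: "topspace X = U \<union> V"
  shows "hom_induced p (subtopology X V) (U \<inter> V) X U id
    \<in> iso (relative_homology_group p (subtopology X V) (U \<inter> V)) (relative_homology_group p X U)"
proof -
  have sub: "U \<subseteq> topspace X" "V \<subseteq> topspace X" using UV by auto
  have "closedin X (topspace X - V)" using V by blast
  then have "X closure_of (topspace X - V) \<subseteq> X interior_of U"
    using U UV by (auto simp: closure_of_closedin interior_of_openin)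
  from homology_excision_axiom[OF this sub(1), of p]
  have "hom_induced p (subtopology X (topspace X - (topspace X - V))) (U - (topspace X - V)) (subtopology X (topspace X)) U id
    \<in> iso (relative_homology_group p (subtopology X (topspace X - (topspace X - V))) (U - (topspace X - V)))
          (relative_homology_group p (subtopology X (topspace X)) U)" .
  moreover have "topspace X - (topspace X - V) = V" "U - (topspace X - V) = U \<inter> V"
    using sub by auto
  ultimately show ?thesis by simp
qed

definition homology_equivalence :: "'a topology \<Rightarrow> 'b topology \<Rightarrow> ('a \<Rightarrow> 'b) \<Rightarrow> bool" where
  "homology_equivalence X Y f \<longleftrightarrow> continuous_map X Y f \<and>
     (\<forall>p. hom_induced p X {} Y {} f \<in> iso (homology_group p X) (homology_group p Y))"

lemma homology_equivalence_compose:
  assumes "homology_equivalence X Y f" "homology_equivalence Y Z g"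
  shows "homology_equivalence X Z (g \<circ> f)"
  unfolding homology_equivalence_def
proof (intro conjI allI)
  have f: "continuous_map X Y f" and g: "continuous_map Y Z g"
    using assms by (auto simp: homology_equivalence_def)
  then show "continuous_map X Z (g \<circ> f)"
    by (rule continuous_map_compose)
  fix p
  show "hom_induced p X {} Z {} (g \<circ> f) \<in> iso (homology_group p X) (homology_group p Z)"
    unfolding hom_induced_compose_empty[OF f g]
    by (rule iso_set_trans) (use assms in \<open>auto simp: homology_equivalence_def\<close>)
qed

lemma homology_equivalence_cancel:
  assumes e: "homology_equivalence X Y e" and fe: "homology_equivalence X Z (f \<circ> e)"
    and f: "continuous_map Y Z f"
  shows "homology_equivalence Y Z f"
  unfolding homology_equivalence_def
proof (intro conjI allI f)
  fix p
  have "hom_induced p Y {} Z {} f \<circ> hom_induced p X {} Y {} e \<in> iso (homology_group p X) (homology_group p Z)"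
    using e fe f by (simp add: homology_equivalence_def flip: hom_induced_compose_empty)
  moreover have "hom_induced p X {} Y {} e \<in> epi (homology_group p X) (homology_group p Y)"
    using e by (auto simp: homology_equivalence_def iso_iff_mon_epi)
  ultimately show "hom_induced p Y {} Z {} f \<in> iso (homology_group p Y) (homology_group p Z)"
    using epi_iso_compose_rev hom_induced_hom by blast
qed

lemma homology_equivalence_eq:
  assumes "homology_equivalence X Y f" "\<And>x. x \<in> topspace X \<Longrightarrow> f x = g x"
  shows "homology_equivalence X Y g"
proof -
  have "hom_induced p X {} Y {} f = hom_induced p X {} Y {} g" for p
    by (rule hom_induced_eq) (rule assms(2))
  then show ?thesis
    using assms(1) continuous_map_eq[of X Y f g] assms(2) by (simp add: homology_equivalence_def)
qed

text \<open>
  The five lemma passes from \<open>V\<close> and \<open>U \<inter> V\<close> to the pair \<open>(V, U \<inter> V)\<close>, excision identifies the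
  homology of this pair with that of \<open>(U \<union> V, U)\<close>, and the five lemma together with \<open>U\<close> gives the
  whole space. Working with pairs replaces the Mayer-Vietoris sequence and its connecting map.
\<close>

lemma homology_equivalence_Mayer_Vietoris:
  assumes f: "continuous_map X Y f"
    and U: "openin Y U" and V: "openin Y V" and UV: "topspace Y = U \<union> V"
    and eqv: "\<And>W. W \<in> {U, V, U \<inter> V} \<Longrightarrow>
        homology_equivalence (subtopology X {x \<in> topspace X. f x \<in> W}) (subtopology Y W) f"
  shows "homology_equivalence X Y f"
  unfolding homology_equivalence_def
proof (intro conjI allI f iso_absolute_homology[OF f])
  define P where "P W = {x \<in> topspace X. f x \<in> W}" for W
  have iso: "hom_induced q (subtopology X (P W)) {} (subtopology Y W) {} f
      \<in> iso (homology_group q (subtopology X (P W))) (homology_group q (subtopology Y W))"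
    if "W \<in> {U, V, U \<inter> V}" for W q
    using eqv[OF that] by (simp add: homology_equivalence_def P_def)
  show fU: "f \<in> P U \<rightarrow> U" by (auto simp: P_def)
  have fV: "continuous_map (subtopology X (P V)) (subtopology Y V) f"
    using f by (rule continuous_map_restrict_pair) (auto simp: P_def)
  have PUV: "P U \<inter> P V = P (U \<inter> V)" "P V \<inter> P (U \<inter> V) = P (U \<inter> V)" "V \<inter> (U \<inter> V) = U \<inter> V"
    by (auto simp: P_def)
  have eX: "hom_induced q (subtopology X (P V)) (P U \<inter> P V) X (P U) id
    \<in> iso (relative_homology_group q (subtopology X (P V)) (P U \<inter> P V)) (relative_homology_group q X (P U))" for q
  proof (rule iso_excision_open)
    show "openin X (P U)" "openin X (P V)"
      using f U V unfolding P_def by (auto intro: openin_continuous_map_preimage)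
    show "topspace X = P U \<union> P V"
      using f UV unfolding P_def by (auto dest: continuous_map_image_subset_topspace)
  qed
  have g: "hom_induced q (subtopology X (P V)) (P U \<inter> P V) (subtopology Y V) (U \<inter> V) f
    \<in> iso (relative_homology_group q (subtopology X (P V)) (P U \<inter> P V)) (relative_homology_group q (subtopology Y V) (U \<inter> V))" for q
  proof (rule iso_relative_homology[OF fV])
    show "f \<in> P U \<inter> P V \<rightarrow> U \<inter> V" by (auto simp: P_def)
  qed (simp_all add: subtopology_subtopology PUV iso)
  show "hom_induced q X (P U) Y U f \<in> iso (relative_homology_group q X (P U)) (relative_homology_group q Y U)" for q
  proof -
    have "hom_induced q X (P U) Y U f \<circ> hom_induced q (subtopology X (P V)) (P U \<inter> P V) X (P U) id
        = hom_induced q (subtopology X (P V)) (P U \<inter> P V) Y U f"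
      by (subst hom_induced_compose[symmetric]) (use f fU in auto)
    also have "\<dots> = hom_induced q (subtopology Y V) (U \<inter> V) Y U id \<circ> 
                    hom_induced q (subtopology X (P V)) (P U \<inter> P V) (subtopology Y V) (U \<inter> V) f"
      by (subst hom_induced_compose[symmetric]) (use fV in \<open>auto simp: P_def\<close>)
    also have "\<dots> \<in> iso (relative_homology_group q (subtopology X (P V)) (P U \<inter> P V)) (relative_homology_group q Y U)"
      by (rule iso_set_trans[OF g iso_excision_open[OF U V UV]])
    finally show ?thesis
      using epi_iso_compose_rev eX[of q] by (metis hom_induced_hom iso_iff_mon_epi)
  qed
  show "hom_induced q (subtopology X (P U)) {} (subtopology Y U) {} f
     \<in> iso (homology_group q (subtopology X (P U))) (homology_group q (subtopology Y U))" for q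
    by (rule iso) simp
qed

section \<open>Acyclic spaces\<close>

lemma iso_trivial_groups:
  assumes "trivial_group G" "trivial_group H" "h \<in> hom G H"
  shows "h \<in> iso G H"
  using assms by (auto simp: trivial_group_def iso_def bij_betw_def hom_one)

lemma acyclic_spaceD:
  assumes "acyclic_space X"
  shows "path_connected_space X" "topspace X \<noteq> {}" "p \<noteq> 0 \<Longrightarrow> trivial_group (homology_group p X)"
proof -
  let ?P = "discrete_topology {()}"
  have iso: "homology_group p X \<cong> homology_group p ?P" for p
    using assms by (simp add: acyclic_space_def)
  have P: "path_connected_space ?P"
    by (simp add: contractible_imp_path_connected_space)
  with isomorphic_homology_imp_path_connectedness[OF iso] show "path_connected_space X" by blast
  show "topspace X \<noteq> {}"
  proof
    assume "topspace X = {}"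
    then have "trivial_group (homology_group 0 X)"
      by (simp add: trivial_homology_group_empty)
    then show False
      using iso[of 0] homology_coefficients[of ?P "()"]
      by (metis nontrivial_integer_group isomorphic_group_triviality group_integer_group group_relative_homology_group
            topspace_discrete_topology)
  qed
  show "trivial_group (homology_group p X)" if "p \<noteq> 0"
    using iso[of p] homology_dimension_axiom[of ?P "()" p] that
    by (metis isomorphic_group_triviality group_relative_homology_group topspace_discrete_topology)
qed

lemma acyclic_space_of_contractible:
  assumes "contractible_space X" "topspace X \<noteq> {}"
  shows "acyclic_space X"
proof -
  obtain a where a: "a \<in> topspace X"
    using assms(2) by blast
  then have id_const: "homotopic_with (\<lambda>_. True) X X id (\<lambda>_. a)"
    using assms(1) unfolding contractible_space_alt by (rule bspec[rotated])
  have "X homotopy_equivalent_space discrete_topology {()}"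
    unfolding homotopy_equivalent_space_def
  proof (intro exI conjI)
    show "homotopic_with (\<lambda>_. True) X X ((\<lambda>_. a) \<circ> (\<lambda>_. ())) id"
      using id_const by (simp add: homotopic_with_symD)
    show "homotopic_with (\<lambda>_. True) (discrete_topology {()}) (discrete_topology {()}) ((\<lambda>_. ()) \<circ> (\<lambda>_. a)) id"
      by (rule homotopic_with_equal) (simp_all add: fun_eq_iff)
  qed (use a in auto)
  then show ?thesis
    by (simp add: acyclic_space_def homotopy_equivalent_space_imp_isomorphic_homology_groups)
qed

text \<open>
  Acyclicity only provides abstract isomorphisms with the homology of a point, so in degree zero the
  induced map needs an argument: both spaces are path connected and nonempty, hence their zeroth
  homology is freely generated by the class of any point, and the map sends such a class to such a
  class.
\<close>

lemma homology_equivalence_acyclic_spaces: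
  assumes X: "acyclic_space X" and Y: "acyclic_space Y" and f: "continuous_map X Y f"
  shows "homology_equivalence X Y f"
  unfolding homology_equivalence_def
proof (intro conjI allI f)
  fix p
  show "hom_induced p X {} Y {} f \<in> iso (homology_group p X) (homology_group p Y)"
  proof (cases "p = 0")
    case False
    have "trivial_group (homology_group p X)" "trivial_group (homology_group p Y)"
      using X Y acyclic_spaceD(3) False by auto
    then show ?thesis
      by (rule iso_trivial_groups) (rule hom_induced_hom)
  next
    case True
    let ?H = "homology_group 0 X" and ?K = "homology_group 0 Y"
    obtain a where a: "a \<in> topspace X" using acyclic_spaceD(2)[OF X] by blast
    define s where "s = restrict (\<lambda>x. a) (standard_simplex 0)"
    have s: "singular_simplex 0 X s"
      by (simp add: singular_simplex_def a s_def)
    have t: "singular_simplex 0 Y (simplex_map 0 f s)"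
      using s f singular_simplex_simplex_map by blast
    define c d where "c = homologous_rel_set 0 X {} (frag_of s)"
      and "d = homologous_rel_set 0 Y {} (frag_of (simplex_map 0 f s))"
    have c: "pow ?H c \<in> iso integer_group ?H" and d: "pow ?K d \<in> iso integer_group ?K"
      unfolding c_def d_def using s t X Y by (auto intro: iso_integer_zeroth_homology_group dest: acyclic_spaceD)
    have cyc: "singular_relcycle 0 X {} (frag_of s)"
      by (simp add: chain_boundary_def s singular_chain_of singular_cycle)
    then have cc: "c \<in> carrier ?H"
      by (simp add: carrier_relative_homology_group_0 c_def)
    have fc: "hom_induced 0 X {} Y {} f c = d"
      using hom_induced_chain_map[of X Y f "{}" "{}" 0 "frag_of s"] f cyc by (simp add: c_def d_def)
    interpret F: group_hom ?H ?K "hom_induced 0 X {} Y {} f"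
      by (simp add: group_hom_def group_hom_axioms_def hom_induced_hom)
    have "hom_induced 0 X {} Y {} f \<circ> pow ?H c = (pow ?K d :: int \<Rightarrow> _)"
      by (rule ext) (simp add: F.hom_int_pow cc fc)
    then have "hom_induced 0 X {} Y {} f \<in> iso ?H ?K"
      using epi_iso_compose_rev[of "pow ?H c" integer_group ?H] c d
      by (metis hom_induced_hom iso_iff_mon_epi)
    then show ?thesis by (simp add: True)
  qed
qed

section \<open>A local criterion over finite spaces\<close>

lemma minimal_open_of_finite:
  assumes "finite (topspace X)" "x \<in> topspace X"
  shows openin_minimal_open: "openin X (minimal_open X x)"
    and mem_minimal_open: "x \<in> minimal_open X x"
    and minimal_open_subset: "\<And>U. openin X U \<Longrightarrow> x \<in> U \<Longrightarrow> minimal_open X x \<subseteq> U"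
proof -
  have "{U. openin X U \<and> x \<in> U} \<subseteq> Pow (topspace X)"
    using openin_subset by blast
  then have "finite {U. openin X U \<and> x \<in> U}"
    using assms(1) finite_subset by blast
  moreover have "{U. openin X U \<and> x \<in> U} \<noteq> {}"
    using assms(2) by blast
  ultimately show "openin X (minimal_open X x)"
    unfolding minimal_open_def by (rule openin_Inter) auto
qed (auto simp: minimal_open_def)

lemma point_le_iff:
  assumes "finite (topspace X)" "x \<in> topspace X" "y \<in> topspace X"
  shows "point_le X x y \<longleftrightarrow> (\<forall>U. openin X U \<longrightarrow> y \<in> U \<longrightarrow> x \<in> U)"
proof
  assume "point_le X x y"
  then show "\<forall>U. openin X U \<longrightarrow> y \<in> U \<longrightarrow> x \<in> U"
    using minimal_open_of_finite[OF assms(1)] assms(2,3) unfolding point_le_def by blast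
next
  assume R: "\<forall>U. openin X U \<longrightarrow> y \<in> U \<longrightarrow> x \<in> U"
  then have "x \<in> minimal_open X y"
    using minimal_open_of_finite[OF assms(1,3)] by blast
  then show "point_le X x y"
    using minimal_open_of_finite[OF assms(1)] assms(2,3) unfolding point_le_def by meson
qed

text \<open>
  Comparable maps are homotopic: the homotopy stays at \<open>f\<close> and jumps to \<open>g\<close> at time one. The
  preimage of an open set is open because the points at which \<open>g\<close> lands in that set form a subset
  of those at which \<open>f\<close> does.
\<close>

lemma homotopic_with_specialization:
  assumes f: "continuous_map X Y f" and g: "continuous_map X Y g"
    and le: "\<And>x U. x \<in> topspace X \<Longrightarrow> openin Y U \<Longrightarrow> g x \<in> U \<Longrightarrow> f x \<in> U"
  shows "homotopic_with (\<lambda>_. True) X Y f g"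
proof -
  let ?I = "top_of_set {0..1::real}"
  let ?h = "\<lambda>(t, x). if t = 1 then g x else f x"
  have "continuous_map (prod_topology ?I X) Y ?h"
    unfolding continuous_map_def
  proof (intro conjI allI impI)
    show "?h \<in> topspace (prod_topology ?I X) \<rightarrow> topspace Y"
      using f g by (auto simp: continuous_map_def Pi_iff)
    fix U assume U: "openin Y U"
    define F G where "F = {x \<in> topspace X. f x \<in> U}" and "G = {x \<in> topspace X. g x \<in> U}"
    have FG: "openin X F" "openin X G"
      using f g U unfolding F_def G_def by (auto intro: openin_continuous_map_preimage)
    have "{0..<1::real} = {0..1} \<inter> {..<1}" by auto
    then have I: "openin ?I {0..<1}"
      by (metis open_lessThan openin_open_Int)
    have "openin (prod_topology ?I X) ({0..1} \<times> G \<union> {0..<1} \<times> F)"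
      using FG I by (intro openin_Un) (auto simp: openin_prod_Times_iff)
    moreover have "{z \<in> topspace (prod_topology ?I X). ?h z \<in> U} = {0..1} \<times> G \<union> {0..<1} \<times> F"
      using le[OF _ U] by (auto simp: F_def G_def split: if_split_asm)
    ultimately show "openin (prod_topology ?I X) {z \<in> topspace (prod_topology ?I X). ?h z \<in> U}"
      by simp
  qed
  then show ?thesis
    unfolding homotopic_with_def by (intro exI[of _ ?h]) auto
qed

text \<open>
  The only open subset of \<open>minimal_open X x\<close> that contains \<open>x\<close> is the whole set, so the identity is
  comparable with the constant map at \<open>x\<close>.
\<close>

lemma acyclic_space_minimal_open:
  assumes "finite (topspace X)" "x \<in> topspace X"
  shows "acyclic_space (subtopology X (minimal_open X x))"
proof (rule acyclic_space_of_contractible)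
  let ?M = "subtopology X (minimal_open X x)"
  note M = minimal_open_of_finite[OF assms]
  have x: "x \<in> topspace ?M"
    using assms M by auto
  then show "topspace ?M \<noteq> {}" by blast
  have "homotopic_with (\<lambda>_. True) ?M ?M id (\<lambda>_. x)"
  proof (rule homotopic_with_specialization)
    fix y U assume "y \<in> topspace ?M" "openin ?M U" "x \<in> U"
    then show "id y \<in> U"
      using M(3)[of U] M(1) by (auto simp: openin_open_subtopology)
  qed (use x in auto)
  then show "contractible_space ?M"
    unfolding contractible_space_def by blast
qed

text \<open>
  The first set is a maximal proper open subset; the second one is the minimal open
  neighbourhood of any point that it misses.
\<close>

lemma openin_minimal_or_decomposable:
  assumes fin: "finite (topspace X)" and V: "openin X V" "V \<noteq> {}"
    and not_min: "\<And>x. x \<in> V \<Longrightarrow> V \<noteq> minimal_open X x"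
  obtains U W where "openin X U" "openin X W" "V = U \<union> W" "U \<subset> V" "W \<subset> V"
proof -
  let ?O = "{U. openin X U \<and> U \<subset> V}"
  have VX: "V \<subseteq> topspace X" using V openin_subset by blast
  have "finite V" using VX fin finite_subset by blast
  then have "finite ?O"
    by (rule finite_subset[rotated, OF finite_Pow_iff[THEN iffD2]]) auto
  moreover have "{} \<in> ?O" using V by auto
  ultimately have "\<exists>U\<in>?O. \<forall>U'\<in>?O. U \<subseteq> U' \<longrightarrow> U = U'"
    by (intro finite_has_maximal) auto
  then obtain U where U: "openin X U" "U \<subset> V"
    and max: "\<And>U'. openin X U' \<Longrightarrow> U' \<subset> V \<Longrightarrow> U \<subseteq> U' \<Longrightarrow> U = U'"
    by auto
  obtain x where x: "x \<in> V" "x \<notin> U" using U(2) by auto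
  note M = minimal_open_of_finite[OF fin subsetD[OF VX x(1)]]
  have MV: "minimal_open X x \<subset> V"
    using M(3)[OF V(1) x(1)] not_min[OF x(1)] by auto
  have "openin X (U \<union> minimal_open X x)" "U \<noteq> U \<union> minimal_open X x"
    using U M(1,2) x by auto
  then have "V = U \<union> minimal_open X x"
    using max[of "U \<union> minimal_open X x"] U(2) MV by auto
  then show thesis
    using U M(1) MV by (intro that[of U "minimal_open X x"])
qed

text \<open>
  A homological form of McCord's theorem for the cover by minimal open sets. The restriction of the
  map over an open set is a homology equivalence by induction on the size of that set: over a minimal
  open set both sides are acyclic, and any other nonempty open set is a union of two smaller ones,
  over which, as over their intersection, the induction hypothesis applies.
\<close>

lemma homology_equivalence_locally_acyclic:
  assumes fin: "finite (topspace Y)" and f: "continuous_map X Y f"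
    and loc: "\<And>y. y \<in> topspace Y \<Longrightarrow>
       acyclic_space (subtopology X {x \<in> topspace X. f x \<in> minimal_open Y y})"
  shows "homology_equivalence X Y f"
proof -
  define P where "P V = {x \<in> topspace X. f x \<in> V}" for V
  have restr: "continuous_map (subtopology X (P V)) (subtopology Y V) f" for V
    using f by (rule continuous_map_restrict_pair) (auto simp: P_def)
  have "homology_equivalence (subtopology X (P V)) (subtopology Y V) f" if "openin Y V" for V
    using that
  proof (induction "card V" arbitrary: V rule: less_induct)
    case less
    have VY: "V \<subseteq> topspace Y" using less.prems openin_subset by blast
    then have finV: "finite V" using fin finite_subset by blast
    consider "V = {}" | y where "y \<in> V" "V = minimal_open Y y"
      | "V \<noteq> {}" "\<And>y. y \<in> V \<Longrightarrow> V \<noteq> minimal_open Y y" by blast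
    then show ?case
    proof cases
      case 1
      then have "topspace (subtopology X (P V)) = {}" "topspace (subtopology Y V) = {}"
        by (auto simp: P_def)
      then have "trivial_group (homology_group p (subtopology X (P V)))"
        "trivial_group (homology_group p (subtopology Y V))" for p
        by (auto intro: trivial_homology_group_empty)
      then have "hom_induced p (subtopology X (P V)) {} (subtopology Y V) {} f
          \<in> iso (homology_group p (subtopology X (P V))) (homology_group p (subtopology Y V))" for p
        by (rule iso_trivial_groups) (rule hom_induced_hom)
      then show ?thesis
        using restr[of V] by (simp add: homology_equivalence_def)
    next
      case 2
      then have y: "y \<in> topspace Y" using VY by blast
      show ?thesis
        using loc[OF y] acyclic_space_minimal_open[OF fin y] restr[of V]
        unfolding 2(2) P_def by (rule homology_equivalence_acyclic_spaces)
    next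
      case 3
      then obtain U W where UW: "openin Y U" "openin Y W" "V = U \<union> W" "U \<subset> V" "W \<subset> V"
        using openin_minimal_or_decomposable[OF fin less.prems] by metis
      show ?thesis
      proof (rule homology_equivalence_Mayer_Vietoris[OF restr, of _ U W])
        show "openin (subtopology Y V) U" "openin (subtopology Y V) W"
          using UW less.prems by (auto simp: openin_open_subtopology)
        show "topspace (subtopology Y V) = U \<union> W"
          using UW VY by auto
        fix Z assume Z: "Z \<in> {U, W, U \<inter> W}"
        then have ZV: "Z \<subset> V" "openin Y Z" using UW by auto
        then have "homology_equivalence (subtopology X (P Z)) (subtopology Y Z) f"
          by (intro less.hyps psubset_card_mono[OF finV])
        moreover have "P V \<inter> {x \<in> topspace (subtopology X (P V)). f x \<in> Z} = P Z" "V \<inter> Z = Z"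
          using ZV by (auto simp: P_def)
        ultimately show "homology_equivalence
            (subtopology (subtopology X (P V)) {x \<in> topspace (subtopology X (P V)). f x \<in> Z})
            (subtopology (subtopology Y V) Z) f"
          by (simp add: subtopology_subtopology)
      qed
    qed
  qed
  from this[OF openin_topspace] have "homology_equivalence (subtopology X (P (topspace Y))) Y f"
    by simp
  moreover have "P (topspace Y) = topspace X"
    using f by (auto simp: P_def continuous_map_def Pi_iff)
  ultimately show ?thesis by simp
qed

section \<open>The barycentric subdivision\<close>

definition chains :: "'a topology \<Rightarrow> 'a set \<Rightarrow> 'a set set" where
  "chains X S = {c. c \<noteq> {} \<and> c \<subseteq> S \<and> (\<forall>x\<in>c. \<forall>y\<in>c. point_le X x y \<or> point_le X y x)}"

text \<open>
  The space of the face poset of the order complex of \<open>S\<close>: the open sets are the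
  families of chains closed under nonempty subchains, that is, the subcomplexes. Here \<open>S\<close> is a
  parameter because the subdivision of a subspace has to be seen as an open subspace of the
  subdivision of \<open>X\<close>.
\<close>

definition subdivision :: "'a topology \<Rightarrow> 'a set \<Rightarrow> 'a set topology" where
  "subdivision X S =
     topology (\<lambda>U. U \<subseteq> chains X S \<and> (\<forall>c\<in>U. \<forall>d. d \<noteq> {} \<longrightarrow> d \<subseteq> c \<longrightarrow> d \<in> U))"

lemma chains_downward: "c \<in> chains X S \<Longrightarrow> d \<noteq> {} \<Longrightarrow> d \<subseteq> c \<Longrightarrow> d \<in> chains X S"
  by (simp add: chains_def) (meson order_trans subsetD)

lemma openin_subdivision:
  "openin (subdivision X S) U \<longleftrightarrow>
     U \<subseteq> chains X S \<and> (\<forall>c\<in>U. \<forall>d. d \<noteq> {} \<longrightarrow> d \<subseteq> c \<longrightarrow> d \<in> U)"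
proof -
  have "istopology (\<lambda>U. U \<subseteq> chains X S \<and> (\<forall>c\<in>U. \<forall>d. d \<noteq> {} \<longrightarrow> d \<subseteq> c \<longrightarrow> d \<in> U))"
    unfolding istopology_def
  proof (intro conjI allI impI ballI)
    fix \<U> c d
    assume \<U>: "\<forall>U\<in>\<U>. U \<subseteq> chains X S \<and> (\<forall>c\<in>U. \<forall>d. d \<noteq> {} \<longrightarrow> d \<subseteq> c \<longrightarrow> d \<in> U)"
    show "\<Union>\<U> \<subseteq> chains X S"
      using \<U> by (simp add: Sup_le_iff)
    assume "c \<in> \<Union>\<U>" "d \<noteq> {}" "d \<subseteq> c"
    then show "d \<in> \<Union>\<U>"
      using \<U> by (meson Union_iff)
  qed (meson IntE IntI le_infI1)+
  then show ?thesis
    by (simp add: subdivision_def topology_inverse')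
qed

lemma openin_subdivision_downward:
  "openin (subdivision X S) U \<Longrightarrow> c \<in> U \<Longrightarrow> d \<noteq> {} \<Longrightarrow> d \<subseteq> c \<Longrightarrow> d \<in> U"
  by (simp add: openin_subdivision)

lemma openin_chains:
  assumes "chains X T \<subseteq> chains X S"
  shows "openin (subdivision X S) (chains X T)"
  unfolding openin_subdivision using assms chains_downward by metis

lemma topspace_subdivision [simp]: "topspace (subdivision X S) = chains X S"
proof -
  have "openin (subdivision X S) (chains X S)"
    by (rule openin_chains) simp
  then show ?thesis
    by (meson openin_subdivision openin_subset openin_topspace subset_antisym)
qed

lemma finite_chains: "finite S \<Longrightarrow> finite (chains X S)"
  by (rule finite_subset[of _ "Pow S"]) (auto simp: chains_def)

lemma subtopology_subdivision:
  assumes "T \<subseteq> S"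
  shows "subtopology (subdivision X S) (chains X T) = subdivision X T"
proof -
  have sub: "chains X T \<subseteq> chains X S"
    using assms by (auto simp: chains_def)
  then have "openin (subdivision X S) (chains X T)"
    by (rule openin_chains)
  then show ?thesis
    using sub by (auto simp: topology_eq openin_open_subtopology openin_subdivision)
qed

lemma continuous_map_subdivision:
  assumes "\<And>c. c \<in> chains X S \<Longrightarrow> \<phi> c \<in> chains Y T"
    and "\<And>c d. c \<in> chains X S \<Longrightarrow> d \<in> chains X S \<Longrightarrow> d \<subseteq> c \<Longrightarrow> \<phi> d \<subseteq> \<phi> c"
  shows "continuous_map (subdivision X S) (subdivision Y T) \<phi>"
  unfolding continuous_map_def
proof (intro conjI allI impI)
  show "\<phi> \<in> topspace (subdivision X S) \<rightarrow> topspace (subdivision Y T)"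
    using assms(1) by simp
  fix U assume U: "openin (subdivision Y T) U"
  have "d \<in> chains X S \<and> \<phi> d \<in> U" if "c \<in> chains X S" "\<phi> c \<in> U" "d \<noteq> {}" "d \<subseteq> c" for c d
  proof -
    have d: "d \<in> chains X S" using that chains_downward by metis
    then have "\<phi> d \<noteq> {}" using assms(1) by (auto simp: chains_def)
    then show ?thesis
      using openin_subdivision_downward[OF U] assms(2) that d by blast
  qed
  then show "openin (subdivision X S) {c \<in> topspace (subdivision X S). \<phi> c \<in> U}"
    unfolding openin_subdivision[of X S] by auto
qed

lemma homotopic_with_subdivision:
  assumes "continuous_map (subdivision X S) (subdivision Y T) \<phi>"
    and "continuous_map (subdivision X S) (subdivision Y T) \<psi>"
    and le: "\<And>c. c \<in> chains X S \<Longrightarrow> \<phi> c \<subseteq> \<psi> c"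
  shows "homotopic_with (\<lambda>_. True) (subdivision X S) (subdivision Y T) \<phi> \<psi>"
proof (rule homotopic_with_specialization[OF assms(1,2)])
  fix c U assume c: "c \<in> topspace (subdivision X S)" "openin (subdivision Y T) U" "\<psi> c \<in> U"
  then have "\<phi> c \<in> chains Y T"
    using assms(1) by (auto simp: continuous_map_def Pi_iff)
  then have "\<phi> c \<noteq> {}"
    by (auto simp: chains_def)
  then show "\<phi> c \<in> U"
    using openin_subdivision_downward[OF c(2,3)] le c(1) by simp
qed

text \<open>
  Comparisons \<open>c \<subseteq> insert x c \<supseteq> {x}\<close> contract the subdivision onto \<open>{x}\<close>, since adjoining a
  greatest point to a chain yields a chain.
\<close>

lemma contractible_subdivision_cone:
  assumes x: "x \<in> S" and top: "\<And>y. y \<in> S \<Longrightarrow> point_le X y x"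
  shows "contractible_space (subdivision X S)"
proof -
  let ?K = "subdivision X S"
  have ins: "insert x c \<in> chains X S" if "c \<in> chains X S" for c
    using that assms unfolding chains_def by (auto simp: point_le_def)
  have sing: "{x} \<in> chains X S"
    using x by (auto simp: chains_def point_le_def)
  have cont: "continuous_map ?K ?K (insert x)"
    by (rule continuous_map_subdivision) (use ins in auto)
  have "homotopic_with (\<lambda>_. True) ?K ?K id (insert x)"
    by (rule homotopic_with_subdivision) (use cont in auto)
  moreover have "homotopic_with (\<lambda>_. True) ?K ?K (\<lambda>_. {x}) (insert x)"
    by (rule homotopic_with_subdivision) (use cont sing in auto)
  ultimately have "homotopic_with (\<lambda>_. True) ?K ?K id (\<lambda>_. {x})"
    by (metis homotopic_with_sym homotopic_with_trans)
  then show ?thesis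
    unfolding contractible_space_def by blast
qed

lemma point_le_antisym:
  assumes "finite (topspace X)" "t0_space X" "x \<in> topspace X" "y \<in> topspace X"
    and "point_le X x y" "point_le X y x"
  shows "x = y"
  using assms unfolding t0_space_def by (metis point_le_iff)

lemma point_le_trans: "point_le X x y \<Longrightarrow> point_le X y z \<Longrightarrow> point_le X x z"
  unfolding point_le_def by blast

text \<open>
  The description is unique for chains of a finite \<open>T\<^sub>0\<close> space, where the specialization preorder is
  antisymmetric.
\<close>

definition chain_top :: "'a topology \<Rightarrow> 'a set \<Rightarrow> 'a" where
  "chain_top X c = (THE m. m \<in> c \<and> (\<forall>x\<in>c. point_le X x m))"

lemma finite_chain_has_top:
  assumes "finite c" "c \<noteq> {}" "\<forall>x\<in>c. \<forall>y\<in>c. point_le X x y \<or> point_le X y x"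
  shows "\<exists>m\<in>c. \<forall>x\<in>c. point_le X x m"
  using assms
proof (induction c rule: finite_ne_induct)
  case (singleton x)
  then show ?case by simp
next
  case (insert x c)
  then obtain m where m: "m \<in> c" "\<forall>y\<in>c. point_le X y m" by blast
  have "point_le X x m \<or> point_le X m x" "point_le X x x"
    using insert.prems m by auto
  then show ?case
    using m point_le_trans by (metis insert_iff)
qed

context
  fixes X :: "'a topology"
  assumes fin: "finite (topspace X)" and t0: "t0_space X"
begin

lemma chain_top_eqI:
  assumes "c \<subseteq> topspace X" "m \<in> c" "\<And>x. x \<in> c \<Longrightarrow> point_le X x m"
  shows "chain_top X c = m"
  unfolding chain_top_def
  by (rule the_equality) (use assms point_le_antisym[OF fin t0] in blast)+

lemma chain_top:
  assumes "c \<in> chains X S" "S \<subseteq> topspace X"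
  shows "chain_top X c \<in> c" "\<And>x. x \<in> c \<Longrightarrow> point_le X x (chain_top X c)"
proof -
  have sub: "c \<subseteq> topspace X" using assms by (auto simp: chains_def)
  then have "finite c" using fin finite_subset by blast
  then obtain m where "m \<in> c" "\<And>x. x \<in> c \<Longrightarrow> point_le X x m"
    using finite_chain_has_top[of c X] assms by (auto simp: chains_def)
  then show "chain_top X c \<in> c" "\<And>x. x \<in> c \<Longrightarrow> point_le X x (chain_top X c)"
    using chain_top_eqI[OF sub] by auto
qed

lemma chain_top_in_open_iff:
  assumes c: "c \<in> chains X S" "S \<subseteq> topspace X" and U: "openin X U"
  shows "chain_top X c \<in> U \<longleftrightarrow> c \<subseteq> U"
proof -
  have "c \<subseteq> topspace X" using c by (auto simp: chains_def)
  then show ?thesis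
    using chain_top[OF c] U point_le_iff[OF fin] by (meson subset_iff)
qed

lemma continuous_map_chain_top:
  assumes "S \<subseteq> topspace X"
  shows "continuous_map (subdivision X S) (subtopology X S) (chain_top X)"
proof -
  have mem: "chain_top X c \<in> S" if "c \<in> chains X S" for c
    using chain_top(1)[OF that assms] that by (auto simp: chains_def)
  have "continuous_map (subdivision X S) X (chain_top X)"
    unfolding continuous_map_def
  proof (intro conjI allI impI)
    show "chain_top X \<in> topspace (subdivision X S) \<rightarrow> topspace X"
      using mem assms by auto
    fix U assume U: "openin X U"
    have "{c \<in> topspace (subdivision X S). chain_top X c \<in> U} = {c \<in> chains X S. c \<subseteq> U}"
      using chain_top_in_open_iff[OF _ assms U] by auto
    moreover have "openin (subdivision X S) {c \<in> chains X S. c \<subseteq> U}"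
      by (auto simp: openin_subdivision intro: chains_downward)
    ultimately show "openin (subdivision X S) {c \<in> topspace (subdivision X S). chain_top X c \<in> U}"
      by simp
  qed
  then show ?thesis
    using mem by (auto simp: continuous_map_in_subtopology)
qed

text \<open>
  The local criterion applies: a chain has its top in the minimal open set \<open>M\<close> of a point \<open>y\<close>
  exactly if it lies in \<open>M\<close>, since open sets are lower sets. So the preimage of \<open>M\<close> is the
  subdivision of \<open>M\<close>, which is contractible because \<open>y\<close> is its greatest point.
\<close>

lemma homology_equivalence_chain_top:
  assumes S: "S \<subseteq> topspace X"
  shows "homology_equivalence (subdivision X S) (subtopology X S) (chain_top X)"
proof (rule homology_equivalence_locally_acyclic[OF _ continuous_map_chain_top[OF S]])
  show finS: "finite (topspace (subtopology X S))"
    using fin by simp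
  fix y assume y: "y \<in> topspace (subtopology X S)"
  define M where "M = minimal_open (subtopology X S) y"
  have yX: "y \<in> topspace X" "y \<in> S" using y by auto
  note mS = minimal_open_of_finite[OF finS y, folded M_def]
  have M: "M = S \<inter> minimal_open X y"
  proof
    have "openin (subtopology X S) (S \<inter> minimal_open X y)"
      using openin_minimal_open[OF fin yX(1)] openin_subtopology_Int2 by blast
    then show "M \<subseteq> S \<inter> minimal_open X y"
      using mS(3) yX mem_minimal_open[OF fin yX(1)] by blast
    obtain U where U: "openin X U" "M = U \<inter> S"
      using mS(1) openin_subtopology by metis
    then show "S \<inter> minimal_open X y \<subseteq> M"
      using minimal_open_subset[OF fin yX(1)] mS(2) by blast
  qed
  have "{c \<in> topspace (subdivision X S). chain_top X c \<in> M} = chains X M"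
  proof (intro subset_antisym subsetI)
    fix c assume "c \<in> {c \<in> topspace (subdivision X S). chain_top X c \<in> M}"
    then have c: "c \<in> chains X S" "chain_top X c \<in> M" by auto
    then have "c \<subseteq> minimal_open X y"
      using chain_top_in_open_iff[OF c(1) S openin_minimal_open[OF fin yX(1)]] M by simp
    then show "c \<in> chains X M"
      using c M by (auto simp: chains_def)
  next
    fix c assume c: "c \<in> chains X M"
    then have "c \<in> chains X S" using M by (auto simp: chains_def)
    moreover from this have "chain_top X c \<in> M"
      using chain_top(1) S c by (auto simp: chains_def)
    ultimately show "c \<in> {c \<in> topspace (subdivision X S). chain_top X c \<in> M}" by simp
  qed
  moreover have "acyclic_space (subdivision X M)"
  proof (rule acyclic_space_of_contractible)
    have "point_le X z y" if "z \<in> M" for z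
      using that S M point_le_iff[OF fin] yX minimal_open_subset[OF fin yX(1)] by blast
    then show "contractible_space (subdivision X M)"
      using contractible_subdivision_cone mS(2) by metis
    have "{y} \<in> chains X M"
      using mS(2) by (auto simp: chains_def point_le_def)
    then show "topspace (subdivision X M) \<noteq> {}" by auto
  qed
  ultimately show "acyclic_space (subtopology (subdivision X S)
      {c \<in> topspace (subdivision X S). chain_top X c \<in> minimal_open (subtopology X S) y})"
    using M by (simp add: subtopology_subdivision flip: M_def)
qed

end

section \<open>Vietoris-like maps\<close>

lemma continuous_map_point_le:
  assumes "finite (topspace X)" "finite (topspace Y)" "continuous_map X Y f"
    and "x \<in> topspace X" "y \<in> topspace X" "point_le X x y"
  shows "point_le Y (f x) (f y)"
proof -
  have fxy: "f x \<in> topspace Y" "f y \<in> topspace Y"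
    using assms by (auto simp: continuous_map_def Pi_iff)
  have "f x \<in> U" if "openin Y U" "f y \<in> U" for U
    using openin_continuous_map_preimage[OF assms(3) that(1)] assms(5,6) that(2)
      point_le_iff[OF assms(1,4,5)] by blast
  then show ?thesis
    using point_le_iff[OF assms(2) fxy] by blast
qed

lemma finite_chain_sorted_list:
  assumes "finite c" "\<forall>x\<in>c. \<forall>y\<in>c. point_le X x y \<or> point_le X y x"
  shows "\<exists>ys. set ys = c \<and> sorted_wrt (point_less X) ys"
  using assms
proof (induction "card c" arbitrary: c)
  case 0
  then show ?case by (intro exI[of _ "[]"]) auto
next
  case (Suc n)
  then have "c \<noteq> {}" by auto
  then obtain m where m: "m \<in> c" "\<forall>x\<in>c. point_le X x m"
    using finite_chain_has_top Suc.prems by metis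
  have "n = card (c - {m})"
    using Suc.hyps(2) Suc.prems(1) m(1) by simp
  then obtain ys where ys: "set ys = c - {m}" "sorted_wrt (point_less X) ys"
    using Suc.hyps(1)[of "c - {m}"] Suc.prems by auto
  have "sorted_wrt (point_less X) (ys @ [m])" "set (ys @ [m]) = c"
    using ys m by (auto simp: sorted_wrt_append point_less_def)
  then show ?case by blast
qed

theorem theorem2p3:
  fixes X :: "'a topology" and Y :: "'b topology" and f :: "'a \<Rightarrow> 'b"
  assumes "finite (topspace X)" and "t0_space X"
    and "finite (topspace Y)" and "t0_space Y"
    and "Vietoris_like_map X Y f"
  shows "\<forall>p. hom_induced p X {} Y {} f \<in> iso (homology_group p X) (homology_group p Y)"
proof -
  note X = assms(1,2) and Y = assms(3,4)
  have f: "continuous_map X Y f"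
    and acyc: "\<And>ys. ys \<noteq> [] \<Longrightarrow> set ys \<subseteq> topspace Y \<Longrightarrow> sorted_wrt (point_less Y) ys \<Longrightarrow>
        acyclic_space (subtopology X (\<Union>y\<in>set ys. {x \<in> topspace X. f x = y}))"
    using assms(5) by (auto simp: Vietoris_like_map_def)
  let ?X = "topspace X" and ?Y = "topspace Y"
  have fim: "f x \<in> ?Y" if "x \<in> ?X" for x
    using f that by (auto simp: continuous_map_def Pi_iff)
  have image_chain: "f ` c \<in> chains Y T" if "c \<in> chains X ?X" "f ` c \<subseteq> T" for c T
    using that continuous_map_point_le[OF X(1) Y(1) f] unfolding chains_def by blast
  have cont: "continuous_map (subdivision X ?X) (subdivision Y ?Y) ((`) f)"
    by (rule continuous_map_subdivision) (use image_chain fim in \<open>auto simp: chains_def\<close>)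
  \<comment> \<open>The preimage of the minimal open set of \<open>c\<close> is the subdivision of the \<open>f\<close>-preimage \<open>S\<close> of \<open>c\<close>;
    this is where the hypothesis on chains enters.\<close>
  have image: "homology_equivalence (subdivision X ?X) (subdivision Y ?Y) ((`) f)"
  proof (rule homology_equivalence_locally_acyclic[OF _ cont])
    show fin_sd: "finite (topspace (subdivision Y ?Y))"
      using Y by (simp add: finite_chains)
    fix c assume c: "c \<in> topspace (subdivision Y ?Y)"
    define S where "S = {x \<in> ?X. f x \<in> c}"
    have S: "S \<subseteq> ?X" by (auto simp: S_def)
    have cY: "c \<in> chains Y ?Y" using c by simp
    have "minimal_open (subdivision Y ?Y) c = chains Y c"
    proof
      have "chains Y c \<subseteq> chains Y ?Y" "c \<in> chains Y c"
        using cY by (auto simp: chains_def)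
      moreover from this have "openin (subdivision Y ?Y) (chains Y c)"
        using openin_chains by blast
      ultimately show "minimal_open (subdivision Y ?Y) c \<subseteq> chains Y c"
        using minimal_open_subset[OF fin_sd c] by simp
      show "chains Y c \<subseteq> minimal_open (subdivision Y ?Y) c"
        using openin_subdivision_downward[OF openin_minimal_open[OF fin_sd c] mem_minimal_open[OF fin_sd c]]
        by (auto simp: chains_def)
    qed
    moreover have "{d \<in> chains X ?X. f ` d \<in> chains Y c} = chains X S"
    proof (intro subset_antisym subsetI)
      fix d assume "d \<in> {d \<in> chains X ?X. f ` d \<in> chains Y c}"
      then show "d \<in> chains X S" by (auto simp: chains_def S_def)
    next
      fix d assume d: "d \<in> chains X S"
      then have "d \<in> chains X ?X" "f ` d \<subseteq> c" by (auto simp: chains_def S_def)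
      then show "d \<in> {d \<in> chains X ?X. f ` d \<in> chains Y c}"
        using image_chain by blast
    qed
    moreover have "acyclic_space (subdivision X S)"
    proof -
      have "finite c" "c \<noteq> {}" "c \<subseteq> ?Y" "\<forall>x\<in>c. \<forall>y\<in>c. point_le Y x y \<or> point_le Y y x"
        using cY Y(1) finite_subset by (auto simp: chains_def)
      moreover from this obtain ys where "set ys = c" "sorted_wrt (point_less Y) ys"
        using finite_chain_sorted_list by metis
      moreover have "(\<Union>y\<in>c. {x \<in> ?X. f x = y}) = S"
        by (auto simp: S_def)
      ultimately have "acyclic_space (subtopology X S)"
        using acyc[of ys] by auto
      moreover have "homology_group p (subdivision X S) \<cong> homology_group p (subtopology X S)" for p
        using homology_equivalence_chain_top[OF X S] is_isoI unfolding homology_equivalence_def by blast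
      ultimately show ?thesis
        unfolding acyclic_space_def using iso_trans by blast
    qed
    ultimately show "acyclic_space (subtopology (subdivision X ?X)
        {d \<in> topspace (subdivision X ?X). f ` d \<in> minimal_open (subdivision Y ?Y) c})"
      using S by (simp add: subtopology_subdivision)
  qed
  have topX: "homology_equivalence (subdivision X ?X) X (chain_top X)"
    using homology_equivalence_chain_top[OF X, of ?X] by simp
  have topY: "homology_equivalence (subdivision Y ?Y) Y (chain_top Y)"
    using homology_equivalence_chain_top[OF Y, of ?Y] by simp
  \<comment> \<open>The images of the top of a chain and the top of its image agree because \<open>f\<close> is order preserving.\<close>
  have square: "(chain_top Y \<circ> (`) f) c = (f \<circ> chain_top X) c" if "c \<in> topspace (subdivision X ?X)" for c
  proof -
    have c: "c \<in> chains X ?X" "c \<subseteq> ?X" using that by (auto simp: chains_def)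
    note top = chain_top[OF X c(1) order_refl]
    have "chain_top Y (f ` c) = f (chain_top X c)"
      by (rule chain_top_eqI[OF Y])
        (use c top fim continuous_map_point_le[OF X(1) Y(1) f] in blast)+
    then show ?thesis by simp
  qed
  have "homology_equivalence (subdivision X ?X) Y (f \<circ> chain_top X)"
    using homology_equivalence_compose[OF image topY] square by (rule homology_equivalence_eq)
  then have "homology_equivalence X Y f"
    using homology_equivalence_cancel[OF topX _ f] by blast
  then show ?thesis
    by (simp add: homology_equivalence_def)
qed

end
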